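(* Let $n \ge 3$ be an integer. The natural density $\rho(\overline E)$ of the set $\overline E \subseteq \mathbb{Z}^{n+1}$ of shifted Eisenstein polynomials of degree $n$ exists and equals $$\rho(\overline E) = 1 - \prod_{p \text{ prime}} \left(1-\frac{(p-1)^2}{p^{n+1}}\right).$$
   Context: Polynomials in $\mathbb{Z}[x]$ of degree at most $n$ are identified with $\mathbb{Z}^{n+1}$ via their coefficients in the basis $\{1,x,\dots,x^n\}$. A polynomial $f(x)=\sum_{i=0}^n\alpha_i x^i\in\mathbb{Z}[x]$ of degree $n$ is $p$-Eisenstein, for a prime $p$, if $p\nmid\alpha_n$, $p\mid\alpha_i$ for all $i\in\{0,\dots,n-1\}$, and $p^2\nmid\alpha_0$. It is Eisenstein if it is $p$-Eisenstein for some prime $p$. Let $E\subseteq\mathbb{Z}^{n+1}$ be the set of Eisenstein polynomials of degree (exactly) $n$. The set of shifted Eisenstein polynomials of degree $n$ is $\overline E=\{f(x)\in\mathbb{Z}^{n+1} : f(x+i)\in E \text{ for some } i\in\mathbb{Z}\}$. For $A\subseteq\mathbb{Z}^d$, the natural density of $A$ is $\rho(A)=\lim_{B\to\infty}\frac{|A\cap[-B,B)^d|}{(2B)^d}$, when the limit exists. Here $d=n+1$. *)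

theory Defs
  imports
    "HOL-Analysis.Infinite_Products"
    "HOL-Computational_Algebra.Polynomial"
    "HOL-Computational_Algebra.Primes"
    "HOL-Library.FuncSet"
begin

definition eisenstein_at :: "nat \<Rightarrow> int poly \<Rightarrow> bool" where
  "eisenstein_at p f \<longleftrightarrow>
     \<not> int p dvd coeff f (degree f) \<and>
     (\<forall>i<degree f. int p dvd coeff f i) \<and>
     \<not> (int p)\<^sup>2 dvd coeff f 0"

definition eisenstein_polys :: "nat \<Rightarrow> int poly set" where
  "eisenstein_polys n = {f. degree f = n \<and> (\<exists>p. prime p \<and> eisenstein_at p f)}"

(* pcompose f [:i, 1:] is the polynomial f(x + i). *)
definition shifted_eisenstein_polys :: "nat \<Rightarrow> int poly set" where
  "shifted_eisenstein_polys n =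
     {f. degree f \<le> n \<and> (\<exists>i::int. pcompose f [:i, 1:] \<in> eisenstein_polys n)}"

(* Elements of Z^d are the functions nat => int that are extensional on {..<d}. *)
definition int_box :: "nat \<Rightarrow> nat \<Rightarrow> (nat \<Rightarrow> int) set" where
  "int_box d B = ({..<d} \<rightarrow>\<^sub>E {- int B..<int B})"

definition coeff_vec :: "nat \<Rightarrow> int poly \<Rightarrow> (nat \<Rightarrow> int)" where
  "coeff_vec n f = restrict (coeff f) {..<n + 1}"

definition has_natural_density :: "nat \<Rightarrow> (nat \<Rightarrow> int) set \<Rightarrow> real \<Rightarrow> bool" where
  "has_natural_density d A r \<longleftrightarrow>
     (\<lambda>B. real (card (A \<inter> int_box d B)) / (2 * real B) ^ d) \<longlonglongrightarrow> r"

end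

theory Submission
  imports Defs "HOL-Number_Theory.Cong"
begin

text \<open>
Fix a prime $p$. A polynomial $f$ that becomes $p$-Eisenstein after the shift by $i$ is congruent to
$c(x-i)^n$ modulo $p$ with $p \nmid c$. So $i$ is unique modulo $p$, and conversely only $i$ modulo
$p$ matters. Since the condition at $p$ involves the coefficients only modulo $p^2$, it has a density,
which is $p$ times that of the $p$-Eisenstein polynomials, that is $(p-1)^2/p^{n+1}$
(lemma \<open>residue_density_shifted_eisenstein\<close>). For finitely many primes these conditions are
independent by the Chinese remainder theorem, so the polynomials that satisfy the condition at some
prime $p \<le> M$ have density $1 - \prod_{p \<le> M} (1 - (p-1)^2/p^{n+1})$
(lemma \<open>small_primes_density\<close>).

To let $M$ tend to infinity one must show that the primes $p > M$ contribute little,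
uniformly in the size $B$ of the box. For $M < p \<le> B$ it is enough that there are at most $p^2$
residue vectors of the form $c(x-i)^n$ among $p^{n+1}$: for $n \<ge> 3$ the proportions are
summable, and the total is $O(1/M)$ (lemma \<open>medium_primes_density_le\<close>).

For $p > B$ counting residue classes no longer helps, and infinitely many primes have to be treated
at once. Here the four top coefficients of $c(x-i)^n$ satisfy two quadratic relations. By the first,
$p$ divides the integer $D = 2n\alpha_n\alpha_{n-2} - (n-1)\alpha_{n-1}^2$ of size $O(B^2)$. Either
$D = 0$, or $D$ has at most two prime divisors above $B$, and then the second relation determines
$\alpha_{n-3}$ modulo such a $p$. In both cases one coefficient is restricted to boundedly many values
by the others, so only $O(B^n)$ polynomials arise (lemma \<open>card_large_primes_le\<close>), a
proportion $O(1/B)$.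
\<close>

section \<open>Densities of periodic conditions on integer vectors\<close>

definition periodic_pred :: "nat \<Rightarrow> nat \<Rightarrow> ((nat \<Rightarrow> int) \<Rightarrow> bool) \<Rightarrow> bool" where
  "periodic_pred d m P \<longleftrightarrow>
     (\<forall>a b. (\<forall>j<d. a j mod int m = b j mod int m) \<longrightarrow> P a = P b)"

definition residue_vectors :: "nat \<Rightarrow> nat \<Rightarrow> ((nat \<Rightarrow> int) \<Rightarrow> bool) \<Rightarrow> (nat \<Rightarrow> int) set" where
  "residue_vectors d m P = {a \<in> {..<d} \<rightarrow>\<^sub>E {0..<int m}. P a}"

definition reduce_vec :: "nat \<Rightarrow> nat \<Rightarrow> (nat \<Rightarrow> int) \<Rightarrow> nat \<Rightarrow> int" where
  "reduce_vec d m a = restrict (\<lambda>j. a j mod int m) {..<d}"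

text \<open>The proportion of residue vectors modulo $m$ that satisfy $P$. It is meaningful only when $P$ is
periodic modulo $m$, and then it is the natural density of $P$.\<close>

definition residue_density :: "nat \<Rightarrow> nat \<Rightarrow> ((nat \<Rightarrow> int) \<Rightarrow> bool) \<Rightarrow> real" where
  "residue_density d m P = real (card (residue_vectors d m P)) / real m ^ d"

lemma periodic_predD:
  "periodic_pred d m P \<Longrightarrow> (\<And>j. j < d \<Longrightarrow> a j mod int m = b j mod int m) \<Longrightarrow> P a = P b"
  by (auto simp: periodic_pred_def)

lemma periodic_pred_mult:
  assumes "periodic_pred d m P"
  shows "periodic_pred d (m * k) P" "periodic_pred d (k * m) P"
proof -
  have *: "x mod int (m * k) = y mod int (m * k) \<Longrightarrow> x mod int m = y mod int m" for x y k
    unfolding mod_eq_dvd_iff by (auto intro: dvd_mult_left)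
  show "periodic_pred d (m * k) P" for k
    unfolding periodic_pred_def
  proof (intro allI impI)
    fix a b :: "nat \<Rightarrow> int"
    assume "\<forall>j<d. a j mod int (m * k) = b j mod int (m * k)"
    then show "P a = P b" using * by (intro periodic_predD[OF assms]) blast
  qed
  then show "periodic_pred d (k * m) P" by (metis mult.commute)
qed

lemma periodic_pred_conj:
  "periodic_pred d m P \<Longrightarrow> periodic_pred d m R \<Longrightarrow> periodic_pred d m (\<lambda>a. P a \<and> R a)"
  unfolding periodic_pred_def by meson

lemma periodic_pred_not: "periodic_pred d m P \<Longrightarrow> periodic_pred d m (\<lambda>a. \<not> P a)"
  unfolding periodic_pred_def by meson

lemma finite_residue_vectors [simp]: "finite (residue_vectors d m P)"
  unfolding residue_vectors_def by (simp add: finite_PiE)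

lemma card_residue_vectors_True: "card (residue_vectors d m (\<lambda>_. True)) = m ^ d"
  by (simp add: residue_vectors_def card_PiE)

lemma residue_vectors_bounds:
  "a \<in> residue_vectors d m P \<Longrightarrow> j < d \<Longrightarrow> 0 \<le> a j \<and> a j < int m"
  by (force simp: residue_vectors_def PiE_iff)

lemma reduce_vec_in:
  assumes "m > 0" "periodic_pred d m P"
  shows "reduce_vec d m a \<in> residue_vectors d m P \<longleftrightarrow> P a"
proof -
  have "P (reduce_vec d m a) = P a"
    by (rule periodic_predD[OF assms(2)]) (simp add: reduce_vec_def)
  with assms show ?thesis
    by (auto simp: residue_vectors_def reduce_vec_def)
qed

lemma reduce_vec_eqD: "reduce_vec d m a = reduce_vec d m b \<Longrightarrow> j < d \<Longrightarrow> a j mod int m = b j mod int m"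
  by (metis lessThan_iff reduce_vec_def restrict_apply')

text \<open>Reduction modulo the two coprime factors is injective on residue vectors modulo $mk$, and the
numbers of vectors on both sides agree, so it is a bijection. It matches the vectors that satisfy
both predicates with pairs of vectors that satisfy one predicate each.\<close>

lemma card_residue_vectors_CRT:
  assumes m: "m > 0" "k > 0" "coprime m k"
    and P: "periodic_pred d m P" and R: "periodic_pred d k R"
  shows "card (residue_vectors d (m * k) (\<lambda>a. P a \<and> R a))
       = card (residue_vectors d m P) * card (residue_vectors d k R)"
proof -
  define T where "T a = (reduce_vec d m a, reduce_vec d k a)" for a
  let ?A = "residue_vectors d (m * k) (\<lambda>_. True)"
  let ?B = "residue_vectors d m (\<lambda>_. True) \<times> residue_vectors d k (\<lambda>_. True)"
  have inj: "inj_on T ?A"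
  proof (rule inj_onI)
    fix a b assume a: "a \<in> ?A" and b: "b \<in> ?A" and eq: "T a = T b"
    have "a j = b j" if j: "j < d" for j
    proof -
      have "int m dvd a j - b j" "int k dvd a j - b j"
        using eq j by (auto simp: T_def simp flip: mod_eq_dvd_iff dest: reduce_vec_eqD)
      then have "int (m * k) dvd a j - b j"
        using m(3) by (simp add: divides_mult)
      then have "a j mod int (m * k) = b j mod int (m * k)"
        by (simp add: mod_eq_dvd_iff)
      then show ?thesis
        using residue_vectors_bounds[OF a j] residue_vectors_bounds[OF b j] by simp
    qed
    then show "a = b"
      using a b by (intro PiE_ext[of a "{..<d}" "\<lambda>_. {0..<int (m * k)}" b])
        (auto simp: residue_vectors_def)
  qed
  have img: "T ` ?A = ?B"
  proof (rule card_subset_eq)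
    show "T ` ?A \<subseteq> ?B"
      using m by (auto simp: T_def reduce_vec_in periodic_pred_def)
    show "card (T ` ?A) = card ?B"
      by (simp add: card_image inj card_cartesian_product card_residue_vectors_True power_mult_distrib)
  qed simp
  let ?V = "residue_vectors d (m * k) (\<lambda>a. P a \<and> R a)"
  let ?W = "residue_vectors d m P \<times> residue_vectors d k R"
  have "T a \<in> ?W \<longleftrightarrow> P a \<and> R a" for a
    using m P R by (simp add: T_def reduce_vec_in)
  then have V: "?V = {a \<in> ?A. T a \<in> ?W}"
    unfolding residue_vectors_def[of d "m * k"] by simp
  have "?W \<subseteq> T ` ?A"
    unfolding img by (intro Sigma_mono) (auto simp: residue_vectors_def)
  moreover have "W \<subseteq> f ` A \<Longrightarrow> f ` {a \<in> A. f a \<in> W} = W" for f :: "(nat \<Rightarrow> int) \<Rightarrow> (nat \<Rightarrow> int) \<times> (nat \<Rightarrow> int)" and A W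
    by blast
  ultimately have "T ` ?V = ?W"
    unfolding V by simp
  moreover have "inj_on T ?V"
    using inj by (rule inj_on_subset) (simp add: V)
  ultimately show ?thesis
    by (metis card_cartesian_product card_image)
qed

lemma residue_density_CRT:
  assumes "m > 0" "k > 0" "coprime m k" "periodic_pred d m P" "periodic_pred d k R"
  shows "residue_density d (m * k) (\<lambda>a. P a \<and> R a) = residue_density d m P * residue_density d k R"
  by (simp add: residue_density_def card_residue_vectors_CRT[OF assms] power_mult_distrib)

lemma residue_density_not:
  assumes "m > 0"
  shows "residue_density d m (\<lambda>a. \<not> P a) = 1 - residue_density d m P"
proof -
  have "residue_vectors d m (\<lambda>_. True) = residue_vectors d m P \<union> residue_vectors d m (\<lambda>a. \<not> P a)"
    by (auto simp: residue_vectors_def)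
  then have "m ^ d = card (residue_vectors d m P) + card (residue_vectors d m (\<lambda>a. \<not> P a))"
    by (metis (no_types, lifting) card_Un_disjoint card_residue_vectors_True disjoint_iff
        finite_residue_vectors mem_Collect_eq residue_vectors_def)
  then have "real m ^ d = real (card (residue_vectors d m P)) + real (card (residue_vectors d m (\<lambda>a. \<not> P a)))"
    by (metis of_nat_add of_nat_power)
  then have eq: "real (card (residue_vectors d m (\<lambda>a. \<not> P a))) = real m ^ d - real (card (residue_vectors d m P))"
    by simp
  show ?thesis using assms unfolding residue_density_def eq by (simp add: diff_divide_distrib)
qed

lemma residue_density_Ball:
  assumes "finite S"
    and "\<And>p. p \<in> S \<Longrightarrow> m p > 0" "\<And>p q. p \<in> S \<Longrightarrow> q \<in> S \<Longrightarrow> p \<noteq> q \<Longrightarrow> coprime (m p) (m q)"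
    and "\<And>p. p \<in> S \<Longrightarrow> periodic_pred d (m p) (P p)"
  shows "periodic_pred d (\<Prod>p\<in>S. m p) (\<lambda>a. \<forall>p\<in>S. P p a)"
    and "residue_density d (\<Prod>p\<in>S. m p) (\<lambda>a. \<forall>p\<in>S. P p a) = (\<Prod>p\<in>S. residue_density d (m p) (P p))"
proof -
  have "periodic_pred d (\<Prod>p\<in>S. m p) (\<lambda>a. \<forall>p\<in>S. P p a) \<and>
    residue_density d (\<Prod>p\<in>S. m p) (\<lambda>a. \<forall>p\<in>S. P p a) = (\<Prod>p\<in>S. residue_density d (m p) (P p))"
    using assms
  proof (induction S rule: finite_induct)
    case empty
    then show ?case
      by (simp add: periodic_pred_def residue_density_def card_residue_vectors_True[of d 1, simplified])
  next
    case (insert q S)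
    have per: "periodic_pred d (\<Prod>p\<in>S. m p) (\<lambda>a. \<forall>p\<in>S. P p a)"
      and dens: "residue_density d (\<Prod>p\<in>S. m p) (\<lambda>a. \<forall>p\<in>S. P p a)
                   = (\<Prod>p\<in>S. residue_density d (m p) (P p))"
      using insert.IH insert.prems by auto
    have q: "periodic_pred d (m q) (P q)" using insert.prems by blast
    have pos: "m q > 0" "(\<Prod>p\<in>S. m p) > 0" using insert.prems by (auto intro!: prod_pos)
    have "coprime (m q) (\<Prod>p\<in>S. m p)"
      by (rule prod_coprime_right) (use insert in auto)
    from residue_density_CRT[OF pos this q per] dens insert.hyps
    have "residue_density d (\<Prod>p\<in>insert q S. m p) (\<lambda>a. \<forall>p\<in>insert q S. P p a)
            = (\<Prod>p\<in>insert q S. residue_density d (m p) (P p))"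
      by simp
    moreover have "periodic_pred d (m q * (\<Prod>p\<in>S. m p)) (\<lambda>a. P q a \<and> (\<forall>p\<in>S. P p a))"
      by (intro periodic_pred_conj periodic_pred_mult q per)
    ultimately show ?case using insert.hyps by simp
  qed
  then show "periodic_pred d (\<Prod>p\<in>S. m p) (\<lambda>a. \<forall>p\<in>S. P p a)"
    and "residue_density d (\<Prod>p\<in>S. m p) (\<lambda>a. \<forall>p\<in>S. P p a) = (\<Prod>p\<in>S. residue_density d (m p) (P p))"
    by auto
qed

text \<open>A residue class modulo $m$ is an arithmetic progression of step $m$, so its members in an interval
correspond to the integers in an interval $m$ times shorter. The bound does not depend on $m$, so it
stays useful for moduli close to the length of the interval.\<close>

lemma card_residue_class_interval:
  fixes r :: int
  assumes m: "m > 0" and r: "0 \<le> r" "r < int m"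
  shows "\<bar>real (card {x \<in> {-int B..<int B}. x mod int m = r}) - 2 * real B / real m\<bar> \<le> 1"
proof -
  let ?l = "\<lceil>(- real B - r) / real m\<rceil>" and ?u = "\<lceil>(real B - r) / real m\<rceil>"
  have "bij_betw (\<lambda>k. r + int m * k) {?l..<?u} {x \<in> {-int B..<int B}. x mod int m = r}"
  proof (rule bij_betw_byWitness[where f' = "\<lambda>x. x div int m"])
    have iff: "k \<in> {?l..<?u} \<longleftrightarrow> r + int m * k \<in> {-int B..<int B}" for k
    proof -
      have "?l \<le> k \<longleftrightarrow> - real B \<le> real_of_int (r + int m * k)"
        using m by (simp add: ceiling_le_iff field_simps)
      also have "\<dots> \<longleftrightarrow> - int B \<le> r + int m * k"
        by linarith
      finally have 1: "?l \<le> k \<longleftrightarrow> - int B \<le> r + int m * k" .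
      have "k < ?u \<longleftrightarrow> real_of_int (r + int m * k) < real B"
        using m by (simp add: less_ceiling_iff field_simps)
      also have "\<dots> \<longleftrightarrow> r + int m * k < int B"
        by linarith
      finally show ?thesis using 1 by auto
    qed
    show "\<forall>a\<in>{?l..<?u}. (r + int m * a) div int m = a"
      using r by simp
    show "(\<lambda>k. r + int m * k) ` {?l..<?u} \<subseteq> {x \<in> {-int B..<int B}. x mod int m = r}"
    proof (rule image_subsetI)
      fix k assume "k \<in> {?l..<?u}"
      then have "r + int m * k \<in> {-int B..<int B}" by (simp only: iff)
      moreover have "(r + int m * k) mod int m = r" using r by simp
      ultimately show "r + int m * k \<in> {x \<in> {-int B..<int B}. x mod int m = r}" by blast
    qed
    have eq: "r + int m * (x div int m) = x" if "x mod int m = r" for x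
      using that by (metis mod_mult_div_eq)
    then show "\<forall>a'\<in>{x \<in> {-int B..<int B}. x mod int m = r}. r + int m * (a' div int m) = a'"
      by blast
    show "(\<lambda>x. x div int m) ` {x \<in> {-int B..<int B}. x mod int m = r} \<subseteq> {?l..<?u}"
    proof (rule image_subsetI)
      fix x assume "x \<in> {x \<in> {-int B..<int B}. x mod int m = r}"
      then have "r + int m * (x div int m) \<in> {-int B..<int B}" using eq by simp
      then show "x div int m \<in> {?l..<?u}" by (simp only: iff)
    qed
  qed
  from bij_betw_same_card[OF this]
  have "card {x \<in> {-int B..<int B}. x mod int m = r} = nat (?u - ?l)"
    by (simp only: card_atLeastLessThan_int)
  moreover have "?l \<le> ?u"
    by (intro ceiling_mono divide_right_mono) auto
  ultimately have c: "real (card {x \<in> {-int B..<int B}. x mod int m = r}) = real_of_int ?u - real_of_int ?l"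
    by simp
  have "(real B - r) / real m - (- real B - r) / real m = 2 * real B / real m"
    using m by (simp add: field_simps)
  then show ?thesis unfolding c by linarith
qed

lemma residue_class_interval_density:
  fixes r :: int
  assumes m: "m > 0" and r: "0 \<le> r" "r < int m"
  shows "(\<lambda>B. real (card {x \<in> {-int B..<int B}. x mod int m = r}) / (2 * real B)) \<longlonglongrightarrow> 1 / real m"
proof -
  let ?c = "\<lambda>B. real (card {x \<in> {-int B..<int B}. x mod int m = r})"
  have "(\<lambda>B. ?c B / (2 * real B) - 1 / real m) \<longlonglongrightarrow> 0"
  proof (rule Lim_null_comparison)
    show "\<forall>\<^sub>F B in sequentially. norm (?c B / (2 * real B) - 1 / real m) \<le> 1 / real B"
      using eventually_gt_at_top[of 0]
    proof eventually_elim
      case (elim B)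
      have "?c B / (2 * real B) - 1 / real m = (?c B - 2 * real B / real m) / (2 * real B)"
        using elim m by (simp add: field_simps)
      also have "norm \<dots> \<le> 1 / (2 * real B)"
        using card_residue_class_interval[OF assms, of B] elim
        by (simp add: abs_divide divide_right_mono)
      also have "\<dots> \<le> 1 / real B" using elim by (simp add: field_simps)
      finally show ?case .
    qed
    show "(\<lambda>B. 1 / real B) \<longlonglongrightarrow> 0" by (rule lim_1_over_n)
  qed
  then show ?thesis by (simp add: LIM_zero_iff)
qed

text \<open>Vectors are grouped by their residue vector; for a fixed residue vector the coordinates can be
chosen independently.\<close>

lemma card_periodic_in_box:
  assumes m: "m > 0" and P: "periodic_pred d m P" and X: "finite X"
  shows "card {a \<in> {..<d} \<rightarrow>\<^sub>E X. P a}
       = (\<Sum>r\<in>residue_vectors d m P. \<Prod>j<d. card {x \<in> X. x mod int m = r j})"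
proof -
  let ?F = "\<lambda>r. PiE {..<d} (\<lambda>j. {x \<in> X. x mod int m = r j})"
  have red: "reduce_vec d m a = r" if "r \<in> residue_vectors d m P" "a \<in> ?F r" for a r
    using that by (auto simp: reduce_vec_def residue_vectors_def fun_eq_iff PiE_iff
        restrict_def extensional_def)
  have "{a \<in> {..<d} \<rightarrow>\<^sub>E X. P a} = (\<Union>r\<in>residue_vectors d m P. ?F r)"
  proof (intro equalityI subsetI)
    fix a assume a: "a \<in> {a \<in> {..<d} \<rightarrow>\<^sub>E X. P a}"
    then have "reduce_vec d m a \<in> residue_vectors d m P" using m P by (simp add: reduce_vec_in)
    moreover have "a \<in> ?F (reduce_vec d m a)"
      using a by (auto simp: reduce_vec_def PiE_iff)
    ultimately show "a \<in> (\<Union>r\<in>residue_vectors d m P. ?F r)" by blast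
  next
    fix a assume "a \<in> (\<Union>r\<in>residue_vectors d m P. ?F r)"
    then obtain r where r: "r \<in> residue_vectors d m P" "a \<in> ?F r" by blast
    have "P a" using red[OF r] r(1) m P by (metis reduce_vec_in)
    with r show "a \<in> {a \<in> {..<d} \<rightarrow>\<^sub>E X. P a}" by (auto simp: PiE_iff)
  qed
  also have "card \<dots> = (\<Sum>r\<in>residue_vectors d m P. card (?F r))"
    using X red by (intro card_UN_disjoint) (auto intro!: finite_PiE, metis red)
  also have "\<dots> = (\<Sum>r\<in>residue_vectors d m P. \<Prod>j<d. card {x \<in> X. x mod int m = r j})"
    by (simp add: card_PiE)
  finally show ?thesis .
qed

text \<open>Each of the finitely many admissible residue vectors contributes a product over the coordinates of
counts in an interval, each asymptotic to $2B/m$.\<close>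

lemma periodic_pred_has_density:
  assumes m: "m > 0" and P: "periodic_pred d m P"
  shows "(\<lambda>B. real (card {a \<in> int_box d B. P a}) / (2 * real B) ^ d) \<longlonglongrightarrow> residue_density d m P"
proof -
  let ?c = "\<lambda>B r. real (card {x \<in> {-int B..<int B}. x mod int m = r})"
  have "(\<lambda>B. \<Sum>r\<in>residue_vectors d m P. \<Prod>j<d. ?c B (r j) / (2 * real B))
      \<longlonglongrightarrow> (\<Sum>r\<in>residue_vectors d m P. \<Prod>j<d. 1 / real m)"
    by (intro tendsto_sum tendsto_prod residue_class_interval_density m)
       (auto dest: residue_vectors_bounds)
  moreover have "(\<Sum>r\<in>residue_vectors d m P. \<Prod>j<d. 1 / real m) = residue_density d m P"
    by (simp add: residue_density_def power_one_over divide_inverse power_inverse)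
  moreover have "(\<Sum>r\<in>residue_vectors d m P. \<Prod>j<d. ?c B (r j) / (2 * real B))
      = real (card {a \<in> int_box d B. P a}) / (2 * real B) ^ d" for B
    unfolding int_box_def
    by (subst card_periodic_in_box[OF m P]) (simp_all add: prod_dividef sum_divide_distrib)
  ultimately show ?thesis by simp
qed

section \<open>The local density of shifted Eisenstein polynomials\<close>

definition vec_poly :: "nat \<Rightarrow> (nat \<Rightarrow> int) \<Rightarrow> int poly" where
  "vec_poly d a = (\<Sum>k<d. monom (a k) k)"

abbreviation taylor_shift :: "int \<Rightarrow> int poly \<Rightarrow> int poly" where
  "taylor_shift i f \<equiv> pcompose f [:i, 1:]"

text \<open>The Eisenstein condition with $n$ in place of the degree. It refers only to coefficients
with a fixed index, so it is visibly invariant under congruences modulo $p^2$, which the degree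
is not.\<close>

definition eisenstein_deg :: "nat \<Rightarrow> nat \<Rightarrow> int poly \<Rightarrow> bool" where
  "eisenstein_deg p n g \<longleftrightarrow>
     \<not> int p dvd coeff g n \<and> (\<forall>j<n. int p dvd coeff g j) \<and> \<not> (int p)\<^sup>2 dvd coeff g 0"

definition shifted_eisenstein_at :: "nat \<Rightarrow> nat \<Rightarrow> int poly \<Rightarrow> bool" where
  "shifted_eisenstein_at p n f \<longleftrightarrow> (\<exists>i. eisenstein_deg p n (taylor_shift i f))"

lemma coeff_vec_poly: "coeff (vec_poly d a) j = (if j < d then a j else 0)"
  by (simp add: vec_poly_def coeff_sum if_distrib[of "\<lambda>x. x = _"] sum.delta)

lemma degree_vec_poly: "degree (vec_poly (n + 1) a) \<le> n"
  by (rule degree_le) (simp add: coeff_vec_poly)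

lemma degree_taylor_shift [simp]: "degree (taylor_shift i f) = degree f"
  by (simp add: degree_pcompose)

lemma taylor_shift_taylor_shift: "taylor_shift i (taylor_shift j f) = taylor_shift (i + j) f"
  by (simp add: pcompose_pCons add.commute flip: pcompose_assoc)

lemma eisenstein_deg_iff:
  assumes "degree g \<le> n"
  shows "eisenstein_deg p n g \<longleftrightarrow> degree g = n \<and> eisenstein_at p g"
proof -
  have "degree g = n" if "\<not> int p dvd coeff g n"
    using that assms by (metis dvd_0_right le_antisym le_degree)
  then show ?thesis by (auto simp: eisenstein_deg_def eisenstein_at_def)
qed

lemma coeff_vec_shifted_eisenstein_polys:
  "coeff_vec n ` shifted_eisenstein_polys n =
     {a \<in> extensional {..<n + 1}. \<exists>p. prime p \<and> shifted_eisenstein_at p n (vec_poly (n + 1) a)}"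
proof -
  have mem: "f \<in> shifted_eisenstein_polys n \<longleftrightarrow>
      degree f \<le> n \<and> (\<exists>p. prime p \<and> shifted_eisenstein_at p n f)" for f
  proof (cases "degree f \<le> n")
    case True
    then have "shifted_eisenstein_at p n f \<longleftrightarrow> (\<exists>i. degree f = n \<and> eisenstein_at p (taylor_shift i f))" for p
      by (simp add: shifted_eisenstein_at_def eisenstein_deg_iff)
    then show ?thesis
      by (simp add: shifted_eisenstein_polys_def eisenstein_polys_def) blast
  qed (simp add: shifted_eisenstein_polys_def)
  have 1: "vec_poly (n + 1) (coeff_vec n f) = f" if "degree f \<le> n" for f
    using that by (intro poly_eqI) (auto simp: coeff_vec_poly coeff_vec_def coeff_eq_0)
  have 2: "coeff_vec n (vec_poly (n + 1) a) = a" if "a \<in> extensional {..<n + 1}" for a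
    using that by (intro extensionalityI[of _ "{..<n + 1}"]) (auto simp: coeff_vec_def coeff_vec_poly)
  show ?thesis
  proof (intro equalityI subsetI)
    fix a assume "a \<in> coeff_vec n ` shifted_eisenstein_polys n"
    then obtain f where a: "a = coeff_vec n f" and f: "f \<in> shifted_eisenstein_polys n" by blast
    have "vec_poly (n + 1) a = f" using f by (simp only: a mem 1)
    moreover have "a \<in> extensional {..<n + 1}" by (simp add: a coeff_vec_def)
    ultimately show "a \<in> {a \<in> extensional {..<n + 1}. \<exists>p. prime p \<and> shifted_eisenstein_at p n (vec_poly (n + 1) a)}"
      using f mem by blast
  next
    fix a assume a: "a \<in> {a \<in> extensional {..<n + 1}. \<exists>p. prime p \<and> shifted_eisenstein_at p n (vec_poly (n + 1) a)}"
    then have "vec_poly (n + 1) a \<in> shifted_eisenstein_polys n"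
      using degree_vec_poly by (simp add: mem)
    moreover have "coeff_vec n (vec_poly (n + 1) a) = a" using a 2 by blast
    ultimately show "a \<in> coeff_vec n ` shifted_eisenstein_polys n" by (metis imageI)
  qed
qed

lemma taylor_shift_cong:
  assumes "[:m:] dvd f - g"
  shows "[:m:] dvd taylor_shift i f - taylor_shift i g"
proof -
  obtain h where "f - g = [:m:] * h" using assms by (elim dvdE)
  then have "taylor_shift i f - taylor_shift i g = [:m:] * taylor_shift i h"
    by (metis pcompose_const pcompose_diff pcompose_mult)
  then show ?thesis by (rule dvdI)
qed

lemma pcompose_cong_dvd:
  fixes f q r :: "'a :: comm_ring_1 poly"
  assumes "a dvd q - r"
  shows "a dvd pcompose f q - pcompose f r"
proof (induction f)
  case (pCons c f)
  have "pcompose (pCons c f) q - pcompose (pCons c f) r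
      = (q - r) * pcompose f q + r * (pcompose f q - pcompose f r)"
    by (simp add: pcompose_pCons algebra_simps)
  then show ?case using pCons.IH assms by simp
qed simp

lemma eisenstein_deg_cong:
  assumes "[:(int p)\<^sup>2:] dvd f - g"
  shows "eisenstein_deg p n f = eisenstein_deg p n g"
proof -
  have 2: "(int p)\<^sup>2 dvd coeff f j - coeff g j" for j
    using assms by (simp add: const_poly_dvd_iff)
  then have 1: "int p dvd coeff f j - coeff g j" for j
    by (metis dvd_trans dvd_triv_left power2_eq_square)
  have "int p dvd coeff f j \<longleftrightarrow> int p dvd coeff g j" for j
    using 1[of j] by (metis dvd_add_right_iff diff_add_cancel)
  moreover have "(int p)\<^sup>2 dvd coeff f 0 \<longleftrightarrow> (int p)\<^sup>2 dvd coeff g 0"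
    using 2[of 0] by (metis dvd_add_right_iff diff_add_cancel)
  ultimately show ?thesis by (simp add: eisenstein_deg_def)
qed

lemma shifted_eisenstein_at_periodic:
  "periodic_pred (n + 1) (p\<^sup>2) (\<lambda>a. shifted_eisenstein_at p n (vec_poly (n + 1) a))"
proof -
  have "eisenstein_deg p n (taylor_shift i (vec_poly (n + 1) a))
      = eisenstein_deg p n (taylor_shift i (vec_poly (n + 1) b))"
    if eq: "\<forall>j<n + 1. a j mod int (p\<^sup>2) = b j mod int (p\<^sup>2)" for a b i
  proof -
    have "(int p)\<^sup>2 dvd a j - b j" if "j < n + 1" for j
      using that eq by (simp add: mod_eq_dvd_iff)
    then have "[:(int p)\<^sup>2:] dvd vec_poly (n + 1) a - vec_poly (n + 1) b"
      by (simp add: const_poly_dvd_iff coeff_vec_poly)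
    then show ?thesis by (intro eisenstein_deg_cong taylor_shift_cong)
  qed
  then show ?thesis
    unfolding periodic_pred_def shifted_eisenstein_at_def by blast
qed

text \<open>An Eisenstein polynomial is congruent to $c x^n$ modulo $p$, and shifting back turns this into
$c(x-i)^n$. The bounds for primes that grow with the box rest on this form alone.\<close>

lemma eisenstein_shift_power_of_linear:
  assumes "degree f \<le> n" "eisenstein_deg p n (taylor_shift i f)"
  obtains c where "\<not> int p dvd c" "[:int p:] dvd f - smult c ([:-i, 1:] ^ n)"
proof
  let ?g = "taylor_shift i f" and ?c = "coeff (taylor_shift i f) n"
  show "\<not> int p dvd ?c" using assms by (simp add: eisenstein_deg_def)
  have "[:int p:] dvd ?g - monom ?c n"
    unfolding const_poly_dvd_iff
  proof
    fix j
    show "int p dvd coeff (?g - monom ?c n) j"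
      using assms coeff_eq_0[of ?g j]
      by (cases j n rule: linorder_cases) (auto simp: eisenstein_deg_def)
  qed
  then have "[:int p:] dvd taylor_shift (-i) ?g - taylor_shift (-i) (monom ?c n)"
    by (rule taylor_shift_cong)
  moreover have "taylor_shift (-i) (monom ?c n) = smult ?c ([:-i, 1:] ^ n)"
    by (simp add: pcompose_altdef map_poly_monom poly_monom)
  moreover have "taylor_shift (-i) ?g = f"
    by (simp add: taylor_shift_taylor_shift)
  ultimately show "[:int p:] dvd f - smult ?c ([:-i, 1:] ^ n)" by simp
qed

text \<open>Modulo $p$ the polynomial is $c(x-i)^n$, whose only root is $i$; but the constant coefficient of
$f(x+i')$ is $f(i')$, and it is divisible by $p$.\<close>

lemma eisenstein_shift_unique:
  assumes "prime p" "n > 0" "degree f \<le> n"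
    and "eisenstein_deg p n (taylor_shift i f)" "eisenstein_deg p n (taylor_shift i' f)"
  shows "int p dvd i' - i"
proof -
  obtain c where c: "\<not> int p dvd c" and dvd: "[:int p:] dvd f - smult c ([:-i, 1:] ^ n)"
    using eisenstein_shift_power_of_linear assms by blast
  then obtain h where "f - smult c ([:-i, 1:] ^ n) = [:int p:] * h" by (elim dvdE)
  then have "poly (f - smult c ([:-i, 1:] ^ n)) i' = poly ([:int p:] * h) i'" by (simp only:)
  then have eq: "c * (i' - i) ^ n = poly f i' - int p * poly h i'"
    by simp
  have "int p dvd coeff (taylor_shift i' f) 0"
    using assms(2,5) unfolding eisenstein_deg_def by blast
  then have "int p dvd poly f i'" by (simp add: pcompose_coeff_0)
  then have "int p dvd c * (i' - i) ^ n"
    unfolding eq by (intro dvd_diff) auto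
  moreover have "prime (int p)" using assms(1) by simp
  ultimately show ?thesis
    using c by (metis prime_dvd_mult_iff prime_dvd_power)
qed

text \<open>A shift by a multiple of $p$ does nothing modulo $p$. The constant coefficient is even unchanged
modulo $p^2$, because the linear coefficient is itself divisible by $p$; this is where
$n \<ge> 2$ enters.\<close>

lemma eisenstein_deg_shift_multiple:
  assumes n: "n \<ge> 2" and g: "eisenstein_deg p n g"
  shows "eisenstein_deg p n (taylor_shift (int p * k) g)"
proof -
  let ?h = "taylor_shift (int p * k) g"
  have "[:int p:] dvd pcompose g [:int p * k, 1:] - pcompose g [:0, 1:]"
    by (rule pcompose_cong_dvd) (simp add: const_poly_dvd_iff coeff_pCons split: nat.splits)
  then have "int p dvd coeff ?h j - coeff g j" for j
    by (simp add: const_poly_dvd_iff)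
  then have 1: "int p dvd coeff ?h j \<longleftrightarrow> int p dvd coeff g j" for j
    by (metis dvd_add_right_iff diff_add_cancel)
  \<comment> \<open>the constant coefficient of the shift is the value of $g = b_0 + b_1 x + x^2 h$ at $pk$\<close>
  obtain b0 b1 h where gh: "g = pCons b0 (pCons b1 h)"
    by (metis pCons_cases)
  have "int p dvd coeff g 1" using g n by (simp add: eisenstein_deg_def)
  then obtain c where c: "b1 = int p * c" by (auto simp: gh elim: dvdE)
  have "coeff ?h 0 - coeff g 0 = (int p)\<^sup>2 * (k * c + k\<^sup>2 * poly h (int p * k))"
    by (simp add: pcompose_coeff_0 gh c power2_eq_square algebra_simps)
  then have "(int p)\<^sup>2 dvd coeff ?h 0 - coeff g 0" by (rule dvdI)
  then have "(int p)\<^sup>2 dvd coeff ?h 0 \<longleftrightarrow> (int p)\<^sup>2 dvd coeff g 0"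
    by (metis dvd_add_right_iff diff_add_cancel)
  with 1 g show ?thesis by (simp add: eisenstein_deg_def)
qed

text \<open>This turns the shifts over all integers into a finite union, which
the uniqueness of the shift modulo $p$ makes disjoint.\<close>

lemma shifted_eisenstein_at_iff_residue:
  assumes "p > 0" "n \<ge> 2"
  shows "shifted_eisenstein_at p n f \<longleftrightarrow> (\<exists>i\<in>{0..<int p}. eisenstein_deg p n (taylor_shift i f))"
proof
  assume "shifted_eisenstein_at p n f"
  then obtain i where i: "eisenstein_deg p n (taylor_shift i f)"
    by (auto simp: shifted_eisenstein_at_def)
  have "int p * - (i div int p) + i = i mod int p"
    by (simp add: minus_mult_div_eq_mod[symmetric])
  then have "eisenstein_deg p n (taylor_shift (i mod int p) f)"
    using eisenstein_deg_shift_multiple[OF assms(2) i, of "- (i div int p)"]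
    by (simp only: taylor_shift_taylor_shift)
  then show "\<exists>i\<in>{0..<int p}. eisenstein_deg p n (taylor_shift i f)"
    using assms(1) by (intro bexI[of _ "i mod int p"]) auto
qed (auto simp: shifted_eisenstein_at_def)

text \<open>The conditions on the coordinates are independent: there are $p^2-p$ leading coefficients, $p-1$
constant coefficients and $p$ choices for each of the other $n-1$ coefficients.\<close>

lemma card_eisenstein_residue_vectors:
  assumes p: "p > 1" and n: "n \<ge> 1"
  shows "card (residue_vectors (n + 1) (p\<^sup>2) (\<lambda>a. eisenstein_deg p n (vec_poly (n + 1) a)))
       = p ^ n * (p - 1)\<^sup>2"
proof -
  let ?M = "{x \<in> {0..<int (p\<^sup>2)}. int p dvd x}"
  let ?X = "\<lambda>j. if j = n then {0..<int (p\<^sup>2)} - ?M else if j = 0 then ?M - {0} else ?M"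
  have "?M = (\<lambda>k. int p * k) ` {0..<int p}"
    using p by (auto simp: power2_eq_square image_iff zero_le_mult_iff elim!: dvdE)
  then have M: "card ?M = p"
    using p by (simp add: card_image inj_on_def)
  have fin: "finite ?M" by (rule finite_subset[of _ "{0..<int (p\<^sup>2)}"]) auto
  have "residue_vectors (n + 1) (p\<^sup>2) (\<lambda>a. eisenstein_deg p n (vec_poly (n + 1) a)) = PiE {..<n + 1} ?X"
  proof (intro set_eqI)
    fix a
    \<comment> \<open>among residues modulo $p^2$, only zero is divisible by $p^2$\<close>
    have z: "(int p)\<^sup>2 dvd x \<longleftrightarrow> x = 0" if "x \<in> {0..<int (p\<^sup>2)}" for x
      using that by (auto dest: zdvd_imp_le)
    show "a \<in> residue_vectors (n + 1) (p\<^sup>2) (\<lambda>a. eisenstein_deg p n (vec_poly (n + 1) a))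
        \<longleftrightarrow> a \<in> PiE {..<n + 1} ?X"
    proof (cases "a \<in> {..<n + 1} \<rightarrow>\<^sub>E {0..<int (p\<^sup>2)}")
      case True
      then have bnd: "a j \<in> {0..<int (p\<^sup>2)}" if "j \<le> n" for j
        using that by (simp add: PiE_iff)
      have "a \<in> PiE {..<n + 1} ?X \<longleftrightarrow> (\<forall>j\<le>n. a j \<in> ?X j)"
        using True by (auto simp: PiE_iff less_Suc_eq_le)
      also have "\<dots> \<longleftrightarrow> \<not> int p dvd a n \<and> (\<forall>j<n. int p dvd a j) \<and> a 0 \<noteq> 0"
        using bnd n by (auto simp: le_less split: if_splits)
      also have "\<dots> \<longleftrightarrow> eisenstein_deg p n (vec_poly (n + 1) a)"
        using z[OF bnd[of 0]] by (simp add: eisenstein_deg_def coeff_vec_poly)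
      finally show ?thesis using True by (simp add: residue_vectors_def)
    next
      case False
      moreover have "PiE {..<n + 1} ?X \<subseteq> {..<n + 1} \<rightarrow>\<^sub>E {0..<int (p\<^sup>2)}"
        by (rule PiE_mono) auto
      ultimately show ?thesis by (auto simp: residue_vectors_def)
    qed
  qed
  then have "card (residue_vectors (n + 1) (p\<^sup>2) (\<lambda>a. eisenstein_deg p n (vec_poly (n + 1) a)))
      = (\<Prod>j<n. card (?X j)) * card (?X n)"
    by (simp only: card_PiE finite_lessThan Suc_eq_plus1[symmetric] prod.lessThan_Suc)
  also have "card (?X n) = p\<^sup>2 - p"
  proof -
    have "card ({0..<int (p\<^sup>2)} - ?M) = card {0..<int (p\<^sup>2)} - card ?M"
      by (rule card_Diff_subset[OF fin]) auto
    then show ?thesis by (simp only: M card_atLeastLessThan_int diff_zero nat_int refl if_True)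
  qed
  also have "(\<Prod>j<n. card (?X j)) = (p - 1) * p ^ (n - 1)"
  proof -
    obtain n' where n': "n = Suc n'" using n by (cases n) auto
    have "(\<Prod>j<n. card (?X j)) = (\<Prod>j<n. if j = 0 then card (?M - {0}) else card ?M)"
      by (intro prod.cong) auto
    also have "\<dots> = card (?M - {0}) * card ?M ^ n'"
      unfolding n' prod.lessThan_Suc_shift by simp
    also have "card (?M - {0}) = p - 1"
      using M p by (simp add: card_Diff_singleton)
    finally show ?thesis using n' M by simp
  qed
  also have "(p - 1) * p ^ (n - 1) * (p\<^sup>2 - p) = p ^ n * (p - 1)\<^sup>2"
    using n by (cases n) (simp_all add: power2_eq_square algebra_simps)
  finally show ?thesis .
qed

text \<open>The shift by $i$ acts on residue vectors modulo $p^2$, and the shift by $-i$ inverts it.\<close>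

lemma card_taylor_shift_residue_vectors:
  assumes "p > 0"
  shows "card (residue_vectors (n + 1) (p\<^sup>2) (\<lambda>a. eisenstein_deg p n (taylor_shift i (vec_poly (n + 1) a))))
       = card (residue_vectors (n + 1) (p\<^sup>2) (\<lambda>a. eisenstein_deg p n (vec_poly (n + 1) a)))"
    (is "card ?A = card ?B")
proof -
  define T where "T k a = reduce_vec (n + 1) (p\<^sup>2) (coeff (taylor_shift k (vec_poly (n + 1) a)))" for k a
  have T: "[:(int p)\<^sup>2:] dvd vec_poly (n + 1) (T k a) - taylor_shift k (vec_poly (n + 1) a)" for k a
    unfolding const_poly_dvd_iff
  proof
    fix j
    show "(int p)\<^sup>2 dvd coeff (vec_poly (n + 1) (T k a) - taylor_shift k (vec_poly (n + 1) a)) j"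
      using coeff_eq_0[of "taylor_shift k (vec_poly (n + 1) a)" j] degree_vec_poly[of n a]
      by (auto simp: T_def reduce_vec_def coeff_vec_poly simp flip: mod_eq_dvd_iff)
  qed
  have T_in: "T k a \<in> residue_vectors (n + 1) (p\<^sup>2) (\<lambda>_. True)" for k a
    unfolding T_def using assms by (subst reduce_vec_in) (auto simp: periodic_pred_def)
  have inv: "T (-k) (T k a) = a" if "a \<in> residue_vectors (n + 1) (p\<^sup>2) (\<lambda>_. True)" for k a
  proof -
    have "[:(int p)\<^sup>2:] dvd taylor_shift (-k) (vec_poly (n + 1) (T k a)) - vec_poly (n + 1) a"
      using taylor_shift_cong[OF T[of k a], of "-k"] by (simp add: taylor_shift_taylor_shift)
    from dvd_add[OF T[of "-k" "T k a"] this]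
    have "[:(int p)\<^sup>2:] dvd vec_poly (n + 1) (T (-k) (T k a)) - vec_poly (n + 1) a"
      by simp
    then have dvd: "(int p)\<^sup>2 dvd coeff (vec_poly (n + 1) (T (-k) (T k a)) - vec_poly (n + 1) a) j" for j
      unfolding const_poly_dvd_iff by blast
    have "(int p)\<^sup>2 dvd T (-k) (T k a) j - a j" if "j < n + 1" for j
      using dvd[of j] that by (simp add: coeff_vec_poly)
    then have "T (-k) (T k a) j mod int (p\<^sup>2) = a j mod int (p\<^sup>2)" if "j < n + 1" for j
      using that by (simp add: mod_eq_dvd_iff)
    then have "T (-k) (T k a) j = a j" if "j < n + 1" for j
      using that residue_vectors_bounds[OF \<open>a \<in> _\<close> that] residue_vectors_bounds[OF T_in that]
      by (metis mod_pos_pos_trivial)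
    then show ?thesis
      using that T_in by (intro PiE_ext[of _ "{..<n + 1}" "\<lambda>_. {0..<int (p\<^sup>2)}"])
        (auto simp: residue_vectors_def)
  qed
  have "bij_betw (T i) ?A ?B"
  proof (rule bij_betw_byWitness[where f' = "T (-i)"])
    show "\<forall>a\<in>?A. T (-i) (T i a) = a"
      using inv by (simp add: residue_vectors_def)
    show "\<forall>a\<in>?B. T i (T (-i) a) = a"
      using inv[of _ "-i"] by (simp add: residue_vectors_def)
    show "T i ` ?A \<subseteq> ?B"
      using T_in[of i] eisenstein_deg_cong[OF T[of i]] by (auto simp: residue_vectors_def)
    have "eisenstein_deg p n (taylor_shift i (vec_poly (n + 1) (T (-i) a)))
        = eisenstein_deg p n (vec_poly (n + 1) a)" for a
      using eisenstein_deg_cong[OF taylor_shift_cong[OF T[of "-i" a], of i]]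
      by (simp add: taylor_shift_taylor_shift)
    then show "T (-i) ` ?B \<subseteq> ?A"
      using T_in[of "-i"] by (auto simp: residue_vectors_def)
  qed
  then show ?thesis by (rule bij_betw_same_card)
qed

text \<open>The $p$ shifts contribute disjoint sets of equal size, so the count is $p$ times that of
unshifted Eisenstein polynomials.\<close>

lemma residue_density_shifted_eisenstein:
  assumes p: "prime p" and n: "n \<ge> 2"
  shows "residue_density (n + 1) (p\<^sup>2) (\<lambda>a. shifted_eisenstein_at p n (vec_poly (n + 1) a))
       = (real p - 1)\<^sup>2 / real p ^ (n + 1)"
proof -
  have p1: "p > 1" using p by (rule prime_gt_1_nat)
  let ?S = "\<lambda>i. residue_vectors (n + 1) (p\<^sup>2) (\<lambda>a. eisenstein_deg p n (taylor_shift i (vec_poly (n + 1) a)))"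
  have disj: "?S i \<inter> ?S i' = {}" if "i \<in> {0..<int p}" "i' \<in> {0..<int p}" "i \<noteq> i'" for i i'
  proof (rule ccontr)
    assume "?S i \<inter> ?S i' \<noteq> {}"
    then obtain a where "a \<in> ?S i" "a \<in> ?S i'" by blast
    then have "int p dvd i' - i"
      using n by (intro eisenstein_shift_unique[OF p _ degree_vec_poly[of n a]])
        (simp_all add: residue_vectors_def)
    then have "i' mod int p = i mod int p" by (simp add: mod_eq_dvd_iff)
    with that show False by simp
  qed
  have "residue_vectors (n + 1) (p\<^sup>2) (\<lambda>a. shifted_eisenstein_at p n (vec_poly (n + 1) a))
      = (\<Union>i\<in>{0..<int p}. ?S i)"
    using p1 n by (auto simp: residue_vectors_def shifted_eisenstein_at_iff_residue)
  also have "card \<dots> = (\<Sum>i\<in>{0..<int p}. card (?S i))"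
    using disj by (intro card_UN_disjoint) auto
  also have "\<dots> = p * (p ^ n * (p - 1)\<^sup>2)"
    using p1 n by (simp add: card_taylor_shift_residue_vectors[simplified]
        card_eisenstein_residue_vectors[simplified])
  finally have "residue_density (n + 1) (p\<^sup>2) (\<lambda>a. shifted_eisenstein_at p n (vec_poly (n + 1) a))
      = real p * (real p ^ n * (real p - 1)\<^sup>2) / (real p ^ 2) ^ (n + 1)"
    using p1 by (simp add: residue_density_def of_nat_diff)
  also have "\<dots> = (real p ^ (n + 1) * (real p - 1)\<^sup>2) / (real p ^ (n + 1) * real p ^ (n + 1))"
    by (simp add: power2_eq_square power_mult_distrib)
  also have "\<dots> = (real p - 1)\<^sup>2 / real p ^ (n + 1)"
    using p1 by simp
  finally show ?thesis .
qed

section \<open>Uniform bounds for medium and large primes\<close>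

lemma finite_filter_interval: "finite {x \<in> {-int B..<int B}. Q x}"
  by (rule finite_subset[of _ "{-int B..<int B}"]) auto

lemma shifted_eisenstein_coeffs:
  assumes "degree f \<le> n" "shifted_eisenstein_at p n f"
  obtains c i where "\<not> int p dvd c"
    "\<And>j. j \<le> n \<Longrightarrow> [coeff f j = c * int (n choose j) * i ^ (n - j)] (mod int p)"
proof -
  obtain i where "eisenstein_deg p n (taylor_shift i f)"
    using assms(2) by (auto simp: shifted_eisenstein_at_def)
  then obtain c where c: "\<not> int p dvd c" and dvd: "[:int p:] dvd f - smult c ([:-i, 1:] ^ n)"
    using eisenstein_shift_power_of_linear assms(1) by blast
  have "[coeff f j = c * int (n choose j) * (-i) ^ (n - j)] (mod int p)" if "j \<le> n" for j
  proof -
    have "int p dvd coeff (f - smult c ([:-i, 1:] ^ n)) j"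
      using dvd unfolding const_poly_dvd_iff by blast
    then show ?thesis
      using that by (simp add: cong_iff_dvd_diff coeff_linear_poly_power mult.assoc)
  qed
  with c show ?thesis by (rule that)
qed

text \<open>Modulo $p$ the polynomial is determined by the pair $(c, i)$, which leaves $p^2$ residue vectors.
For $p \<le> B$ a residue class meets the interval $[-B,B)$ in at most $2B/p + 1 \<le> 3B/p$
points.\<close>

lemma card_shifted_eisenstein_in_box_le:
  assumes p: "prime p" "p \<le> B"
  shows "real (card {a \<in> int_box (n + 1) B. shifted_eisenstein_at p n (vec_poly (n + 1) a)})
      \<le> real p ^ 2 * (3 * real B / real p) ^ (n + 1)"
proof -
  have p0: "p > 0" using p(1) by (rule prime_gt_0_nat)
  define r where "r = (\<lambda>(c, i) j. (c * int (n choose j) * i ^ (n - j)) mod int p)"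
  let ?F = "\<lambda>ci. PiE {..<n + 1} (\<lambda>j. {x \<in> {-int B..<int B}. x mod int p = r ci j})"
  let ?I = "{0..<int p} \<times> {0..<int p}"
  have "{a \<in> int_box (n + 1) B. shifted_eisenstein_at p n (vec_poly (n + 1) a)} \<subseteq> (\<Union>ci\<in>?I. ?F ci)"
  proof
    fix a assume a: "a \<in> {a \<in> int_box (n + 1) B. shifted_eisenstein_at p n (vec_poly (n + 1) a)}"
    then obtain c i where ci: "\<And>j. j \<le> n \<Longrightarrow>
        [coeff (vec_poly (n + 1) a) j = c * int (n choose j) * i ^ (n - j)] (mod int p)"
      using shifted_eisenstein_coeffs[OF degree_vec_poly] by blast
    have "a j mod int p = r (c mod int p, i mod int p) j" if "j < n + 1" for j
    proof -
      have "a j mod int p = (c * int (n choose j) * i ^ (n - j)) mod int p"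
        using ci[of j] that by (simp add: coeff_vec_poly cong_def)
      also have "\<dots> = (c mod int p * int (n choose j) * (i mod int p) ^ (n - j)) mod int p"
      proof -
        have "[c * int (n choose j) * i ^ (n - j)
            = c mod int p * int (n choose j) * (i mod int p) ^ (n - j)] (mod int p)"
          by (intro cong_mult cong_pow cong_refl) (simp_all add: cong_def)
        then show ?thesis by (simp only: cong_def)
      qed
      finally show ?thesis by (simp add: r_def)
    qed
    then have "a \<in> ?F (c mod int p, i mod int p)"
      using a by (simp add: int_box_def PiE_iff)
    moreover have "(c mod int p, i mod int p) \<in> ?I" using p0 by simp
    ultimately show "a \<in> (\<Union>ci\<in>?I. ?F ci)" by blast
  qed
  moreover have "finite (\<Union>ci\<in>?I. ?F ci)"
    by (intro finite_UN_I finite_PiE finite_filter_interval) auto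
  ultimately have "card {a \<in> int_box (n + 1) B. shifted_eisenstein_at p n (vec_poly (n + 1) a)}
      \<le> card (\<Union>ci\<in>?I. ?F ci)"
    by (rule card_mono[rotated])
  also have "\<dots> \<le> (\<Sum>ci\<in>?I. card (?F ci))"
    by (rule card_UN_le) simp
  finally have "real (card {a \<in> int_box (n + 1) B. shifted_eisenstein_at p n (vec_poly (n + 1) a)})
      \<le> real (\<Sum>ci\<in>?I. card (?F ci))"
    by (simp only: of_nat_le_iff)
  also have "\<dots> = (\<Sum>ci\<in>?I. real (card (?F ci)))" by (rule of_nat_sum)
  also have "\<dots> \<le> (\<Sum>ci\<in>?I. (3 * real B / real p) ^ (n + 1))"
  proof (rule sum_mono)
    fix ci assume "ci \<in> ?I"
    have "real (card {x \<in> {-int B..<int B}. x mod int p = r ci j}) \<le> 3 * real B / real p" for j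
    proof -
      have "0 \<le> r ci j" "r ci j < int p" using p0 by (auto simp: r_def split: prod.splits)
      from card_residue_class_interval[OF p0 this, of B]
      have "real (card {x \<in> {-int B..<int B}. x mod int p = r ci j}) \<le> 2 * real B / real p + 1"
        by linarith
      also have "1 \<le> real B / real p" using p p0 by simp
      finally show ?thesis by simp
    qed
    then have "(\<Prod>j<n + 1. real (card {x \<in> {-int B..<int B}. x mod int p = r ci j}))
        \<le> (\<Prod>j<n + 1. 3 * real B / real p)"
      by (intro prod_mono) auto
    then show "real (card (?F ci)) \<le> (3 * real B / real p) ^ (n + 1)"
      by (simp only: card_PiE finite_lessThan of_nat_prod prod_constant card_lessThan)
  qed
  also have "\<dots> = real p ^ 2 * (3 * real B / real p) ^ (n + 1)"
    by (simp add: card_cartesian_product power2_eq_square)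
  finally show ?thesis .
qed

lemma sum_inverse_squares_tail:
  assumes "M > 0"
  shows "(\<Sum>p\<in>{M<..B}. 1 / real p ^ 2) \<le> 1 / real M"
proof (cases "M \<le> B")
  case True
  then have "(\<Sum>p\<in>{M<..B}. 1 / real p ^ 2) \<le> 1 / real M - 1 / real B"
  proof (induction B rule: dec_induct)
    case (step B)
    have "real B > 0" using step assms by simp
    then have "1 / real (Suc B) ^ 2 \<le> 1 / (real B * real (Suc B))"
      unfolding power2_eq_square by (intro divide_left_mono mult_right_mono mult_pos_pos) auto
    also have "\<dots> = 1 / real B - 1 / real (Suc B)"
      using \<open>real B > 0\<close> by (simp add: field_simps)
    finally have "1 / real (Suc B) ^ 2 \<le> 1 / real B - 1 / real (Suc B)" .
    moreover have "{M<..Suc B} = insert (Suc B) {M<..B}" using step by auto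
    ultimately show ?case using step.IH by simp
  qed simp
  then show ?thesis by (smt (verit) divide_nonneg_nonneg of_nat_0_le_iff)
qed simp

text \<open>For a single prime the proportion is at most a constant times $p^2/p^{n+1}$, which is
at most $1/p^2$ up to that constant because $n \<ge> 3$.\<close>

lemma medium_primes_density_le:
  assumes n: "n \<ge> 3" and M: "M > 0" and B: "B > 0"
  shows "real (card {a \<in> int_box (n + 1) B.
            \<exists>p. prime p \<and> M < p \<and> p \<le> B \<and> shifted_eisenstein_at p n (vec_poly (n + 1) a)})
          / (2 * real B) ^ (n + 1) \<le> (3 / 2) ^ (n + 1) / real M"
proof -
  let ?A = "\<lambda>p. {a \<in> int_box (n + 1) B. shifted_eisenstein_at p n (vec_poly (n + 1) a)}"
  let ?I = "{p \<in> {M<..B}. prime p}"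
  have eq: "{a \<in> int_box (n + 1) B.
            \<exists>p. prime p \<and> M < p \<and> p \<le> B \<and> shifted_eisenstein_at p n (vec_poly (n + 1) a)}
      = (\<Union>p\<in>?I. ?A p)"
    by auto
  have "card (\<Union>p\<in>?I. ?A p) \<le> (\<Sum>p\<in>?I. card (?A p))"
    by (rule card_UN_le) simp
  then have "real (card (\<Union>p\<in>?I. ?A p)) \<le> real (\<Sum>p\<in>?I. card (?A p))"
    by (rule of_nat_mono)
  also have "\<dots> = (\<Sum>p\<in>?I. real (card (?A p)))" by (rule of_nat_sum)
  also have "\<dots> \<le> (\<Sum>p\<in>?I. (3 / 2) ^ (n + 1) * (2 * real B) ^ (n + 1) * (1 / real p ^ 2))"
  proof (rule sum_mono)
    fix p assume p: "p \<in> ?I"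
    then have p1: "real p \<ge> 1" by auto
    have "real (card (?A p)) \<le> real p ^ 2 * (3 * real B / real p) ^ (n + 1)"
      using p by (intro card_shifted_eisenstein_in_box_le) auto
    also have "\<dots> = (3 * real B) ^ (n + 1) * (real p ^ 2 / real p ^ (n + 1))"
      by (simp only: power_divide) simp
    also have "real p ^ 2 / real p ^ (n + 1) \<le> 1 / real p ^ 2"
    proof -
      have "real p ^ 4 \<le> real p ^ (n + 1)" using p1 n by (intro power_increasing) auto
      moreover have "real p ^ 2 * real p ^ 2 = real p ^ 4" by (simp flip: power_add)
      ultimately show ?thesis using p1 by (simp add: field_simps)
    qed
    also have "3 * real B = 3 / 2 * (2 * real B)" by simp
    finally show "real (card (?A p)) \<le> (3 / 2) ^ (n + 1) * (2 * real B) ^ (n + 1) * (1 / real p ^ 2)"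
      by (simp only: power_mult_distrib) (simp add: mult_left_mono)
  qed
  also have "\<dots> = (3 / 2) ^ (n + 1) * (2 * real B) ^ (n + 1) * (\<Sum>p\<in>?I. 1 / real p ^ 2)"
    by (rule sum_distrib_left[symmetric])
  also have "\<dots> \<le> (3 / 2) ^ (n + 1) * (2 * real B) ^ (n + 1) * (1 / real M)"
  proof (rule mult_left_mono)
    have "(\<Sum>p\<in>?I. 1 / real p ^ 2) \<le> (\<Sum>p\<in>{M<..B}. 1 / real p ^ 2)"
      by (rule sum_mono2) auto
    then show "(\<Sum>p\<in>?I. 1 / real p ^ 2) \<le> 1 / real M"
      using sum_inverse_squares_tail[OF M, of B] by linarith
  qed simp
  finally show ?thesis unfolding eq using B by (simp add: divide_le_eq mult_ac)
qed

text \<open>Erasing the coordinate $j$ leaves at most $(2B)^{d-1}$ vectors, and each has at most $K$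
extensions in $A$.\<close>

lemma card_box_fibre_le:
  assumes A: "A \<subseteq> int_box d B" and j: "j < d"
    and fib: "\<And>a. a \<in> A \<Longrightarrow> card {x \<in> {-int B..<int B}. a(j := x) \<in> A} \<le> K"
  shows "card A \<le> K * (2 * B) ^ (d - 1)"
proof -
  let ?pr = "\<lambda>a :: nat \<Rightarrow> int. a(j := undefined)"
  let ?P = "({..<d} - {j}) \<rightarrow>\<^sub>E {-int B..<int B}"
  have finA: "finite A"
    using A by (rule finite_subset) (simp add: int_box_def finite_PiE)
  have img: "?pr ` A \<subseteq> ?P"
  proof (rule image_subsetI)
    fix a assume "a \<in> A"
    then have "a \<in> {..<d} \<rightarrow>\<^sub>E {-int B..<int B}" using A by (auto simp: int_box_def)
    then show "?pr a \<in> ?P" by (simp add: PiE_iff extensional_def)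
  qed
  have finP: "finite ?P" by (simp add: finite_PiE)
  have cardP: "card ?P = (2 * B) ^ (d - 1)"
    using j by (simp add: card_PiE power_mult_distrib nat_mult_distrib)
  have "card {a \<in> A. ?pr a = b} \<le> K" if b: "b \<in> ?pr ` A" for b
  proof -
    obtain a where a: "a \<in> A" "b = ?pr a" using b by blast
    have "{a' \<in> A. ?pr a' = b} \<subseteq> (\<lambda>x. a(j := x)) ` {x \<in> {-int B..<int B}. a(j := x) \<in> A}"
    proof
      fix a' assume a': "a' \<in> {a' \<in> A. ?pr a' = b}"
      then have "?pr a' = ?pr a" using a(2) by simp
      then have "a' k = a k" if "k \<noteq> j" for k
        using that by (metis fun_upd_other)
      then have "a' = a(j := a' j)" by auto
      moreover have "a' j \<in> {-int B..<int B}"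
        using a' A j by (auto simp: int_box_def PiE_iff)
      ultimately show "a' \<in> (\<lambda>x. a(j := x)) ` {x \<in> {-int B..<int B}. a(j := x) \<in> A}"
        using a' by (intro image_eqI[of _ _ "a' j"]) auto
    qed
    then have "card {a' \<in> A. ?pr a' = b} \<le> card {x \<in> {-int B..<int B}. a(j := x) \<in> A}"
      by (rule surj_card_le[OF finite_filter_interval])
    then show ?thesis using fib[OF a(1)] by linarith
  qed
  then have "(\<Sum>b\<in>?pr ` A. card {a \<in> A. ?pr a = b}) \<le> (\<Sum>b\<in>?pr ` A. K)"
    by (rule sum_mono)
  moreover have "card A \<le> (\<Sum>b\<in>?pr ` A. card {a \<in> A. ?pr a = b})"
  proof -
    have eq: "(\<Union>b\<in>?pr ` A. {a \<in> A. ?pr a = b}) = A" by blast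
    have "card (\<Union>b\<in>?pr ` A. {a \<in> A. ?pr a = b}) \<le> (\<Sum>b\<in>?pr ` A. card {a \<in> A. ?pr a = b})"
      using finA by (intro card_UN_le finite_imageI)
    then show ?thesis by (simp only: eq)
  qed
  moreover have "card (?pr ` A) \<le> (2 * B) ^ (d - 1)"
    using card_mono[OF finP img] cardP by simp
  then have "card (?pr ` A) * K \<le> (2 * B) ^ (d - 1) * K" by (rule mult_right_mono) simp
  ultimately show ?thesis
    unfolding sum_constant of_nat_id mult.commute[of K] by linarith
qed

text \<open>Eliminating $c$ and $i$ from the four top coefficients of $c(x-i)^n$ leaves two homogeneous
quadratic relations. They follow from $2\binom n2 = n(n-1)$ and
$3\binom n3 = (n-2)\binom n2$. The first relation is one integer that $p$ must divide; if the
three coefficients in it are known, the second determines $\alpha_{n-3}$ modulo $p$, provided that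
$p > n$.\<close>

lemma shifted_eisenstein_coeff_relations:
  assumes n: "n \<ge> 3" and f: "degree f \<le> n" "shifted_eisenstein_at p n f"
  shows "\<not> int p dvd coeff f n"
    and "int p dvd 2 * int n * coeff f n * coeff f (n - 2) - (int n - 1) * (coeff f (n - 1))\<^sup>2"
    and "int p dvd 3 * int n * coeff f n * coeff f (n - 3)
           - (int n - 2) * coeff f (n - 1) * coeff f (n - 2)"
proof -
  obtain c i where c: "\<not> int p dvd c" and ci: "\<And>j. j \<le> n \<Longrightarrow>
      [coeff f j = c * int (n choose j) * i ^ (n - j)] (mod int p)"
    using shifted_eisenstein_coeffs[OF f] by blast
  have 0: "[coeff f n = c] (mod int p)" using ci[of n] by simp
  have "n choose (n - 1) = n" "n choose (n - 2) = n choose 2" "n choose (n - 3) = n choose 3"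
    using n binomial_symmetric[of 1 n] binomial_symmetric[of 2 n] binomial_symmetric[of 3 n] by auto
  with n ci[of "n - 1"] ci[of "n - 2"] ci[of "n - 3"]
  have 1: "[coeff f (n - 1) = c * int n * i] (mod int p)"
    and 2: "[coeff f (n - 2) = c * int (n choose 2) * i\<^sup>2] (mod int p)"
    and 3: "[coeff f (n - 3) = c * int (n choose 3) * i ^ 3] (mod int p)"
    by simp_all
  have "2 * (n choose 2) = n * (n - 1)"
    using binomial_absorption[of 1 n] by (simp add: numeral_2_eq_2)
  then have "int (2 * (n choose 2)) = int (n * (n - 1))" by (simp only:)
  then have b2: "2 * int (n choose 2) = int n * (int n - 1)"
    using n by (simp add: of_nat_diff)
  have "3 * (n choose 3) = (n - 2) * (n choose 2)"
    using binomial_absorption[of 2 n] binomial_absorb_comp[of n 2]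
    by (simp add: numeral_3_eq_3 numeral_2_eq_2)
  then have "int (3 * (n choose 3)) = int ((n - 2) * (n choose 2))" by (simp only:)
  then have b3: "3 * int (n choose 3) = (int n - 2) * int (n choose 2)"
    using n by (simp add: of_nat_diff)
  show "\<not> int p dvd coeff f n" using 0 c by (simp add: cong_dvd_iff)
  have "[2 * int n * coeff f n * coeff f (n - 2) - (int n - 1) * (coeff f (n - 1))\<^sup>2
      = 2 * int n * c * (c * int (n choose 2) * i\<^sup>2) - (int n - 1) * (c * int n * i)\<^sup>2] (mod int p)"
    by (intro cong_diff cong_mult cong_pow cong_refl 0 1 2)
  also have "2 * int n * c * (c * int (n choose 2) * i\<^sup>2) = int n * c * (c * (2 * int (n choose 2)) * i\<^sup>2)"
    by simp
  also have "\<dots> - (int n - 1) * (c * int n * i)\<^sup>2 = 0"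
    unfolding b2 by (simp add: algebra_simps power2_eq_square)
  finally show "int p dvd 2 * int n * coeff f n * coeff f (n - 2) - (int n - 1) * (coeff f (n - 1))\<^sup>2"
    by (simp add: cong_0_iff)
  have "[3 * int n * coeff f n * coeff f (n - 3) - (int n - 2) * coeff f (n - 1) * coeff f (n - 2)
      = 3 * int n * c * (c * int (n choose 3) * i ^ 3)
        - (int n - 2) * (c * int n * i) * (c * int (n choose 2) * i\<^sup>2)] (mod int p)"
    by (intro cong_diff cong_mult cong_pow cong_refl 0 1 2 3)
  also have "3 * int n * c * (c * int (n choose 3) * i ^ 3)
      = int n * c * (c * (3 * int (n choose 3)) * i ^ 3)"
    by simp
  also have "\<dots> - (int n - 2) * (c * int n * i) * (c * int (n choose 2) * i\<^sup>2) = 0"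
    unfolding b3 by (simp add: algebra_simps power2_eq_square power3_eq_cube)
  finally show "int p dvd 3 * int n * coeff f n * coeff f (n - 3)
           - (int n - 2) * coeff f (n - 1) * coeff f (n - 2)"
    by (simp add: cong_0_iff)
qed

text \<open>Three such primes would have a product that exceeds $B^3$ and divides $D$.\<close>

lemma card_large_prime_divisors_le_2:
  fixes D :: int
  assumes "D \<noteq> 0" "\<bar>D\<bar> \<le> int B ^ 3"
  shows "finite {p. prime p \<and> B < p \<and> int p dvd D}" "card {p. prime p \<and> B < p \<and> int p dvd D} \<le> 2"
proof -
  let ?P = "{p. prime p \<and> B < p \<and> int p dvd D}"
  have "?P \<subseteq> {p. p dvd nat \<bar>D\<bar>}" by auto
  moreover have "finite {p. p dvd nat \<bar>D\<bar>}"
    by (rule finite_divisors_nat) (use assms(1) in simp)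
  ultimately show "finite ?P" by (rule finite_subset)
  show "card ?P \<le> 2"
  proof (rule ccontr)
    assume "\<not> card ?P \<le> 2"
    then have "3 \<le> card ?P" by simp
    then obtain T where T: "T \<subseteq> ?P" "card T = 3"
      by (meson obtain_subset_with_card_n)
    then obtain p q r where pqr: "T = {p, q, r}" "p \<noteq> q" "p \<noteq> r" "q \<noteq> r"
      by (auto simp: card_3_iff)
    have pr: "prime p" "prime q" "prime r" and gt: "B < p" "B < q" "B < r"
      and dvd: "int p dvd D" "int q dvd D" "int r dvd D"
      using T(1) pqr(1) by auto
    have cop: "coprime p q" "coprime p r" "coprime q r"
      using pr pqr by (simp_all add: primes_coprime)
    then have "int p * int q * int r dvd D"
      using dvd by (intro divides_mult) auto
    then have "int p * int q * int r \<le> \<bar>D\<bar>"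
      using assms(1) dvd_imp_le_int[of D "int p * int q * int r"] by (simp add: abs_mult)
    moreover have "int B * int B < int p * int q"
      using gt by (intro mult_strict_mono) auto
    then have "int B * int B * int B < int p * int q * int r"
      using gt by (intro mult_strict_mono) auto
    ultimately show False using assms(2) by (simp add: power3_eq_cube)
  qed
qed

text \<open>Let $D = 2n\alpha_n\alpha_{n-2} - (n-1)\alpha_{n-1}^2$, which $p$ divides. If $D = 0$, then
$\alpha_{n-2}$ is determined by the other coefficients, as $\alpha_n \<noteq> 0$. If
$D \<noteq> 0$, then at most two primes are possible, as $|D| \<le> 3nB^2 \<le> B^3$; they depend only on
$\alpha_n, \alpha_{n-1}, \alpha_{n-2}$, and each leaves one residue class modulo $p$, hence at
most three values, for $\alpha_{n-3}$. So either way one coordinate is lost.\<close>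

lemma card_large_primes_le:
  assumes n: "n \<ge> 3" and B: "B \<ge> 3 * n"
  shows "card {a \<in> int_box (n + 1) B. \<exists>p. prime p \<and> B < p \<and> shifted_eisenstein_at p n (vec_poly (n + 1) a)}
      \<le> 7 * (2 * B) ^ n"
proof -
  define D where "D a = 2 * int n * a n * a (n - 2) - (int n - 1) * (a (n - 1))\<^sup>2" for a :: "nat \<Rightarrow> int"
  define E where "E a = 3 * int n * a n * a (n - 3) - (int n - 2) * a (n - 1) * a (n - 2)" for a :: "nat \<Rightarrow> int"
  have ne: "n \<noteq> n - 2" "n - 1 \<noteq> n - 2" "n \<noteq> n - 3" "n - 1 \<noteq> n - 3" "n - 2 \<noteq> n - 3"
    using n by auto
  let ?A0 = "{a \<in> int_box (n + 1) B. a n \<noteq> 0 \<and> D a = 0}"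
  let ?A1 = "{a \<in> int_box (n + 1) B. D a \<noteq> 0 \<and>
      (\<exists>p. prime p \<and> B < p \<and> \<not> int p dvd a n \<and> int p dvd D a \<and> int p dvd E a)}"
  have "card ?A0 \<le> 1 * (2 * B) ^ (n + 1 - 1)"
  proof (rule card_box_fibre_le[where j = "n - 2"])
    fix a assume "a \<in> ?A0"
    have "x = y" if "a(n - 2 := x) \<in> ?A0" "a(n - 2 := y) \<in> ?A0" for x y
    proof -
      have "D (a(n - 2 := x)) = D (a(n - 2 := y))" using that by simp
      moreover have "a n \<noteq> 0" using that(1) n by (simp split: if_splits)
      ultimately show ?thesis using n ne by (simp add: D_def)
    qed
    then show "card {x \<in> {-int B..<int B}. a(n - 2 := x) \<in> ?A0} \<le> 1"
      using card_le_Suc0_iff_eq[OF finite_filter_interval, of B "\<lambda>x. a(n - 2 := x) \<in> ?A0"]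
      unfolding One_nat_def by blast
  qed auto
  moreover have "card ?A1 \<le> 6 * (2 * B) ^ (n + 1 - 1)"
  proof (rule card_box_fibre_le[where j = "n - 3"])
    fix a assume a: "a \<in> ?A1"
    let ?P = "{p. prime p \<and> B < p \<and> int p dvd D a}"
    let ?X = "\<lambda>p. {x \<in> {-int B..<int B}. \<not> int p dvd a n \<and> int p dvd E (a(n - 3 := x))}"
    have bnd: "\<bar>a j\<bar> \<le> int B" if "j \<le> n" for j
    proof -
      have "a j \<in> {-int B..<int B}" using a that by (auto simp: int_box_def PiE_iff)
      then show ?thesis by auto
    qed
    have "\<bar>D a\<bar> \<le> \<bar>2 * int n * a n * a (n - 2)\<bar> + \<bar>(int n - 1) * (a (n - 1))\<^sup>2\<bar>"
      unfolding D_def by (rule abs_triangle_ineq4)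
    also have "\<dots> = 2 * int n * (\<bar>a n\<bar> * \<bar>a (n - 2)\<bar>) + (int n - 1) * (\<bar>a (n - 1)\<bar> * \<bar>a (n - 1)\<bar>)"
      using n by (simp add: abs_mult power2_eq_square)
    also have "\<dots> \<le> 2 * int n * (int B * int B) + (int n - 1) * (int B * int B)"
      using n bnd by (intro add_mono mult_left_mono mult_mono) auto
    also have "\<dots> \<le> (3 * int n) * (int B * int B)"
      by (simp add: algebra_simps)
    also have "\<dots> \<le> int B * (int B * int B)"
      using B by (intro mult_right_mono) auto
    finally have "\<bar>D a\<bar> \<le> int B ^ 3" by (simp add: power3_eq_cube)
    then have P: "finite ?P" "card ?P \<le> 2"
      using a card_large_prime_divisors_le_2[of "D a" B] by auto
    \<comment> \<open>all solutions lie in one class modulo $p$, and $2B/p + 1 \<le> 3$\<close>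
    have X: "card (?X p) \<le> 3" if p: "p \<in> ?P" for p
    proof (cases "?X p = {}")
      case False
      then obtain y where y: "y \<in> ?X p" by blast
      have "x mod int p = y mod int p" if x: "x \<in> ?X p" for x
      proof -
        have "int p dvd E (a(n - 3 := x)) - E (a(n - 3 := y))"
          using x y by (intro dvd_diff) auto
        also have "E (a(n - 3 := x)) - E (a(n - 3 := y)) = int (3 * n) * (a n * (x - y))"
          using ne by (simp add: E_def algebra_simps)
        finally have "int p dvd int (3 * n) * (a n * (x - y))" .
        moreover have "prime (int p)" using p by simp
        moreover have "\<not> int p dvd int (3 * n)"
          using p B n unfolding int_dvd_int_iff by (auto dest: dvd_imp_le)
        moreover have "\<not> int p dvd a n" using y by simp
        ultimately have "int p dvd x - y" by (metis prime_dvd_mult_iff)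
        then show ?thesis by (simp add: mod_eq_dvd_iff)
      qed
      then have "?X p \<subseteq> {x \<in> {-int B..<int B}. x mod int p = y mod int p}" by blast
      then have "card (?X p) \<le> card {x \<in> {-int B..<int B}. x mod int p = y mod int p}"
        by (intro card_mono finite_filter_interval)
      moreover have "real (card {x \<in> {-int B..<int B}. x mod int p = y mod int p}) \<le> 3"
      proof -
        have p0: "p > 0" using p by auto
        then have "2 * real B / real p \<le> 2" using p by (simp add: divide_le_eq)
        moreover have "0 \<le> y mod int p" "y mod int p < int p" using p0 by auto
        ultimately show ?thesis using card_residue_class_interval[OF p0, of "y mod int p" B] by linarith
      qed
      ultimately show ?thesis by linarith
    next
      case True
      then show ?thesis by (simp only: card.empty)
    qed
    have "{x \<in> {-int B..<int B}. a(n - 3 := x) \<in> ?A1} \<subseteq> (\<Union>p\<in>?P. ?X p)"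
    proof
      fix x assume x: "x \<in> {x \<in> {-int B..<int B}. a(n - 3 := x) \<in> ?A1}"
      \<comment> \<open>so the set of candidate primes is the same along the whole fibre\<close>
      have "D (a(n - 3 := x)) = D a" "(a(n - 3 := x)) n = a n"
        using ne by (simp_all add: D_def)
      with x show "x \<in> (\<Union>p\<in>?P. ?X p)" by auto
    qed
    moreover have "finite (\<Union>p\<in>?P. ?X p)"
      using P(1) by (intro finite_UN_I finite_filter_interval)
    ultimately have "card {x \<in> {-int B..<int B}. a(n - 3 := x) \<in> ?A1} \<le> card (\<Union>p\<in>?P. ?X p)"
      by (rule card_mono[rotated])
    also have "\<dots> \<le> (\<Sum>p\<in>?P. card (?X p))" using P(1) by (rule card_UN_le)
    also have "\<dots> \<le> (\<Sum>p\<in>?P. 3)" using X by (rule sum_mono)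
    also have "\<dots> \<le> 6" using P(2) by simp
    finally show "card {x \<in> {-int B..<int B}. a(n - 3 := x) \<in> ?A1} \<le> 6" .
  qed auto
  moreover have "card {a \<in> int_box (n + 1) B. \<exists>p. prime p \<and> B < p \<and> shifted_eisenstein_at p n (vec_poly (n + 1) a)}
      \<le> card (?A0 \<union> ?A1)"
  proof (rule card_mono)
    have "finite (int_box (n + 1) B)" by (simp add: int_box_def finite_PiE)
    then show "finite (?A0 \<union> ?A1)" by simp
    show "{a \<in> int_box (n + 1) B. \<exists>p. prime p \<and> B < p \<and> shifted_eisenstein_at p n (vec_poly (n + 1) a)}
        \<subseteq> ?A0 \<union> ?A1"
    proof
      fix a assume "a \<in> {a \<in> int_box (n + 1) B. \<exists>p. prime p \<and> B < p \<and> shifted_eisenstein_at p n (vec_poly (n + 1) a)}"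
      then obtain p where a: "a \<in> int_box (n + 1) B" and p: "prime p" "B < p"
        and se: "shifted_eisenstein_at p n (vec_poly (n + 1) a)" by blast
      have "\<not> int p dvd a n" "int p dvd D a" "int p dvd E a"
        using shifted_eisenstein_coeff_relations[OF n degree_vec_poly se]
        by (simp_all add: coeff_vec_poly D_def E_def less_Suc_eq_le)
      moreover from this(1) have "a n \<noteq> 0" by auto
      ultimately show "a \<in> ?A0 \<union> ?A1" using a p by blast
    qed
  qed
  moreover have "card (?A0 \<union> ?A1) \<le> card ?A0 + card ?A1" by (rule card_Un_le)
  ultimately show ?thesis by simp
qed

section \<open>Passage to the limit\<close>

lemma euler_factor_LIMSEQ:
  assumes n: "n \<ge> 3"
  shows "(\<lambda>M. \<Prod>p | prime p \<and> p \<le> M. 1 - (real p - 1)\<^sup>2 / real p ^ (n + 1))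
      \<longlonglongrightarrow> (\<Prod>p. if prime p then 1 - (real p - 1)\<^sup>2 / real p ^ (n + 1) else 1)"
proof -
  let ?f = "\<lambda>p. if prime p then 1 - (real p - 1)\<^sup>2 / real p ^ (n + 1) else 1"
  have "norm (?f p - 1) \<le> inverse (real p ^ 2)" for p
  proof (cases "prime p")
    case True
    then have p: "real p \<ge> 1" using prime_ge_1_nat by auto
    have "(real p - 1)\<^sup>2 * real p ^ 2 \<le> real p ^ 2 * real p ^ 2"
      using p by (intro mult_right_mono power_mono) auto
    also have "\<dots> = real p ^ 4" by (simp flip: power_add)
    also have "\<dots> \<le> real p ^ (n + 1)" using p n by (intro power_increasing) auto
    finally show ?thesis using True p by (simp add: field_simps)
  qed simp
  then have "summable (\<lambda>p. norm (?f p - 1))"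
    by (intro summable_comparison_test'[OF inverse_power_summable[of 2], of 0]) auto
  then have "convergent_prod ?f"
    by (intro abs_convergent_prod_imp_convergent_prod summable_imp_abs_convergent_prod)
  then have "(\<lambda>M. \<Prod>p\<le>M. ?f p) \<longlonglongrightarrow> prodinf ?f"
    by (rule convergent_prod_LIMSEQ)
  moreover have "(\<Prod>p\<le>M. ?f p) = (\<Prod>p | prime p \<and> p \<le> M. 1 - (real p - 1)\<^sup>2 / real p ^ (n + 1))" for M
  proof -
    have "{p. prime p \<and> p \<le> M} = {p \<in> {..M}. prime p}" by auto
    then show ?thesis by (simp only: prod.inter_filter finite_atMost)
  qed
  ultimately show ?thesis by simp
qed

text \<open>By the Chinese remainder theorem the conditions at distinct primes are independent, so the
polynomials that satisfy none of them have the product of the complementary densities.\<close>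

lemma small_primes_density:
  assumes n: "n \<ge> 2"
  shows "(\<lambda>B. real (card {a \<in> int_box (n + 1) B.
            \<exists>p. prime p \<and> p \<le> M \<and> shifted_eisenstein_at p n (vec_poly (n + 1) a)}) / (2 * real B) ^ (n + 1))
      \<longlonglongrightarrow> 1 - (\<Prod>p | prime p \<and> p \<le> M. 1 - (real p - 1)\<^sup>2 / real p ^ (n + 1))"
proof -
  let ?S = "{p. prime p \<and> p \<le> M}"
  let ?m = "\<Prod>p\<in>?S. p\<^sup>2"
  let ?Q = "\<lambda>p a. shifted_eisenstein_at p n (vec_poly (n + 1) a)"
  have fin: "finite ?S" by (rule finite_subset[of _ "{..M}"]) auto
  have pos: "p\<^sup>2 > 0" if "p \<in> ?S" for p :: nat
    using that prime_gt_0_nat by auto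
  have cop: "coprime (p\<^sup>2) (q\<^sup>2)" if "p \<in> ?S" "q \<in> ?S" "p \<noteq> q" for p q :: nat
    using that by (simp add: primes_coprime)
  have per: "periodic_pred (n + 1) (p\<^sup>2) (\<lambda>a. \<not> ?Q p a)" for p
    by (intro periodic_pred_not shifted_eisenstein_at_periodic)
  note Ball = residue_density_Ball[of ?S "\<lambda>p. p\<^sup>2", OF fin pos cop per]
  have m: "?m > 0" using pos by (intro prod_pos) auto
  have "residue_density (n + 1) ?m (\<lambda>a. \<forall>p\<in>?S. \<not> ?Q p a)
      = (\<Prod>p\<in>?S. residue_density (n + 1) (p\<^sup>2) (\<lambda>a. \<not> ?Q p a))"
    by (rule Ball(2))
  also have "\<dots> = (\<Prod>p\<in>?S. 1 - (real p - 1)\<^sup>2 / real p ^ (n + 1))"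
  proof (rule prod.cong)
    fix p assume p: "p \<in> ?S"
    show "residue_density (n + 1) (p\<^sup>2) (\<lambda>a. \<not> ?Q p a) = 1 - (real p - 1)\<^sup>2 / real p ^ (n + 1)"
      using residue_density_not[OF pos[OF p], of "n + 1" "?Q p"]
        residue_density_shifted_eisenstein[of p n] p n by simp
  qed simp
  finally have "residue_density (n + 1) ?m (\<lambda>a. \<not> (\<forall>p\<in>?S. \<not> ?Q p a))
      = 1 - (\<Prod>p\<in>?S. 1 - (real p - 1)\<^sup>2 / real p ^ (n + 1))"
    using residue_density_not[OF m, of "n + 1" "\<lambda>a. \<forall>p\<in>?S. \<not> ?Q p a"] by simp
  moreover have "(\<lambda>B. real (card {a \<in> int_box (n + 1) B. \<not> (\<forall>p\<in>?S. \<not> ?Q p a)}) / (2 * real B) ^ (n + 1))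
      \<longlonglongrightarrow> residue_density (n + 1) ?m (\<lambda>a. \<not> (\<forall>p\<in>?S. \<not> ?Q p a))"
    by (intro periodic_pred_has_density m periodic_pred_not Ball(1))
  moreover have "(\<not> (\<forall>p\<in>?S. \<not> ?Q p a)) = (\<exists>p. prime p \<and> p \<le> M \<and> ?Q p a)" for a
    by blast
  ultimately show ?thesis by simp
qed

text \<open>A prime that witnesses the shifted Eisenstein property is small ($p \<le> M$), medium
($M < p \<le> B$) or large ($p > B$).\<close>

lemma shifted_eisenstein_count_sandwich:
  fixes n M B :: nat
  assumes n: "n \<ge> 3" and M: "M > 0" and B: "B \<ge> 3 * n"
  defines "Q \<equiv> \<lambda>p a. prime p \<and> shifted_eisenstein_at p n (vec_poly (n + 1) a)"
  defines "W \<equiv> real (card {a \<in> int_box (n + 1) B. \<exists>p\<le>M. Q p a}) / (2 * real B) ^ (n + 1)"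
    and "U \<equiv> real (card {a \<in> int_box (n + 1) B. \<exists>p. Q p a}) / (2 * real B) ^ (n + 1)"
  shows "W \<le> U" and "U \<le> W + (3 / 2) ^ (n + 1) / real M + 7 / (2 * real B)"
proof -
  let ?box = "int_box (n + 1) B"
  let ?S = "{a \<in> ?box. \<exists>p\<le>M. Q p a}"
    and ?T = "{a \<in> ?box. \<exists>p. prime p \<and> M < p \<and> p \<le> B \<and> shifted_eisenstein_at p n (vec_poly (n + 1) a)}"
    and ?L = "{a \<in> ?box. \<exists>p. prime p \<and> B < p \<and> shifted_eisenstein_at p n (vec_poly (n + 1) a)}"
    and ?A = "{a \<in> ?box. \<exists>p. Q p a}"
  have B0: "B > 0" using n B by simp
  have fin: "finite {a \<in> ?box. R a}" for R
    by (rule finite_subset[of _ ?box]) (auto simp: int_box_def finite_PiE)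
  have "card ?S \<le> card ?A" by (rule card_mono[OF fin]) blast
  then show "W \<le> U" unfolding W_def U_def by (intro divide_right_mono) auto
  have "?A \<subseteq> ?S \<union> (?T \<union> ?L)"
  proof
    fix a assume "a \<in> ?A"
    then obtain p where "a \<in> ?box" "Q p a" by blast
    then show "a \<in> ?S \<union> (?T \<union> ?L)"
      unfolding Q_def by (cases "p \<le> M"; cases "p \<le> B") (auto simp: not_le)
  qed
  then have "card ?A \<le> card (?S \<union> (?T \<union> ?L))"
    by (rule card_mono[rotated]) (intro finite_UnI fin)
  also have "\<dots> \<le> card ?S + card (?T \<union> ?L)" by (rule card_Un_le)
  also have "card (?T \<union> ?L) \<le> card ?T + card ?L" by (rule card_Un_le)
  finally have "card ?A \<le> card ?S + (card ?T + card ?L)" by simp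
  then have "real (card ?A) \<le> real (card ?S) + real (card ?T) + real (card ?L)"
    by linarith
  then have "U \<le> W + real (card ?T) / (2 * real B) ^ (n + 1) + real (card ?L) / (2 * real B) ^ (n + 1)"
    unfolding U_def W_def add_divide_distrib[symmetric] by (intro divide_right_mono) auto
  moreover have "real (card ?T) / (2 * real B) ^ (n + 1) \<le> (3 / 2) ^ (n + 1) / real M"
    by (rule medium_primes_density_le[OF n M B0])
  moreover have "real (card ?L) / (2 * real B) ^ (n + 1) \<le> 7 / (2 * real B)"
  proof -
    have "real (card ?L) \<le> real (7 * (2 * B) ^ n)"
      using card_large_primes_le[OF n B] by (rule of_nat_mono)
    then have "real (card ?L) / (2 * real B) ^ (n + 1) \<le> 7 * (2 * real B) ^ n / (2 * real B) ^ (n + 1)"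
      by (intro divide_right_mono) auto
    also have "\<dots> = 7 / (2 * real B)" using B0 by simp
    finally show ?thesis .
  qed
  ultimately show "U \<le> W + (3 / 2) ^ (n + 1) / real M + 7 / (2 * real B)" by linarith
qed

text \<open>The error has a part $s_M$ that does not vanish as $B$ grows with $M$ fixed, so the limit in $B$
has to be taken before the limit in $M$.\<close>

lemma LIMSEQ_double_sandwich:
  fixes u :: "nat \<Rightarrow> real" and w :: "nat \<Rightarrow> nat \<Rightarrow> real"
  assumes w: "\<And>M. w M \<longlonglongrightarrow> L M" and L: "L \<longlonglongrightarrow> l"
    and s: "s \<longlonglongrightarrow> 0" and t: "t \<longlonglongrightarrow> 0"
    and bound: "\<And>M. M > 0 \<Longrightarrow> eventually (\<lambda>B. w M B \<le> u B \<and> u B \<le> w M B + s M + t B) sequentially"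
  shows "u \<longlonglongrightarrow> l"
proof (rule tendstoI)
  fix e :: real assume e: "e > 0"
  then have e4: "e / 4 > 0" by simp
  from tendstoD[OF L e4] tendstoD[OF s e4]
  have "eventually (\<lambda>M. dist (L M) l < e / 4 \<and> dist (s M) 0 < e / 4 \<and> M > 0) sequentially"
    using eventually_gt_at_top[of 0] by eventually_elim auto
  then obtain M where M: "dist (L M) l < e / 4" "dist (s M) 0 < e / 4" "M > 0"
    using eventually_happens'[OF sequentially_bot] by blast
  from tendstoD[OF w[of M] e4] tendstoD[OF t e4] bound[OF M(3)]
  show "eventually (\<lambda>B. dist (u B) l < e) sequentially"
  proof eventually_elim
    case (elim B)
    then show ?case using M unfolding dist_real_def by linarith
  qed
qed

theorem theorem9:
  fixes n :: nat
  assumes "n \<ge> 3"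
  shows "has_natural_density (n + 1) (coeff_vec n ` shifted_eisenstein_polys n)
           (1 - (\<Prod>p. if prime p then 1 - (real p - 1)\<^sup>2 / real p ^ (n + 1) else 1))"
proof -
  let ?Q = "\<lambda>p a. prime p \<and> shifted_eisenstein_at p n (vec_poly (n + 1) a)"
  let ?w = "\<lambda>M B. real (card {a \<in> int_box (n + 1) B. \<exists>p\<le>M. ?Q p a}) / (2 * real B) ^ (n + 1)"
  let ?u = "\<lambda>B. real (card {a \<in> int_box (n + 1) B. \<exists>p. ?Q p a}) / (2 * real B) ^ (n + 1)"
  let ?L = "\<lambda>M. 1 - (\<Prod>p | prime p \<and> p \<le> M. 1 - (real p - 1)\<^sup>2 / real p ^ (n + 1))"
  have "int_box (n + 1) B \<subseteq> extensional {..<n + 1}" for B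
    unfolding int_box_def PiE_def by blast
  then have "(coeff_vec n ` shifted_eisenstein_polys n) \<inter> int_box (n + 1) B
      = {a \<in> int_box (n + 1) B. \<exists>p. ?Q p a}" for B
    unfolding coeff_vec_shifted_eisenstein_polys by blast
  moreover have "?u \<longlonglongrightarrow> 1 - (\<Prod>p. if prime p then 1 - (real p - 1)\<^sup>2 / real p ^ (n + 1) else 1)"
  proof (rule LIMSEQ_double_sandwich)
    have "(\<exists>p\<le>M. ?Q p a) = (\<exists>p. prime p \<and> p \<le> M \<and> shifted_eisenstein_at p n (vec_poly (n + 1) a))" for M a
      by blast
    then show "?w M \<longlonglongrightarrow> ?L M" for M
      using small_primes_density[of n M] assms by simp
    show "?L \<longlonglongrightarrow> 1 - (\<Prod>p. if prime p then 1 - (real p - 1)\<^sup>2 / real p ^ (n + 1) else 1)"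
      by (intro tendsto_diff tendsto_const euler_factor_LIMSEQ assms)
    show "(\<lambda>M. (3 / 2) ^ (n + 1) / real M) \<longlonglongrightarrow> 0" "(\<lambda>B. 7 / (2 * real B)) \<longlonglongrightarrow> 0"
      using tendsto_mult_right_zero[OF lim_1_over_n[where 'a = real], of "(3 / 2) ^ (n + 1)"]
        tendsto_mult_right_zero[OF lim_1_over_n[where 'a = real], of "7 / 2"] by simp_all
    show "eventually (\<lambda>B. ?w M B \<le> ?u B \<and> ?u B \<le> ?w M B + (3 / 2) ^ (n + 1) / real M + 7 / (2 * real B)) sequentially"
      if "M > 0" for M
      using eventually_ge_at_top[of "3 * n"]
      by eventually_elim (intro conjI shifted_eisenstein_count_sandwich assms that)
  qed
  ultimately show ?thesis by (simp only: has_natural_density_def)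
qed

end
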